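(* Let $\mathcal{M}$ be the linear operator on $\mathbb{R}^{I_1\times\cdots\times I_N}$ given by $\mathcal{M}(\mathscr{X})=\mathscr{X}-\mathscr{X}\times_1A^{(1)}\times_2A^{(2)}\cdots\times_NA^{(N)}$ with $A^{(n)}\in\mathbb{R}^{I_n\times I_n}$, let $\mathscr{F}\in\mathbb{R}^{I_1\times\cdots\times I_N}$, and let $k\ge1$. Suppose the tensor Golub--Kahan bidiagonalization process (GKB_BTF, described in the context) applied to $\mathcal{M}$ and $\mathscr{F}$ with $m=k+1$ does not break down, and let $\mathscr{V}_j,\mathscr{U}_j$, $\alpha_j,\beta_j$ be the quantities it computes, and $T_k$, $\bar T_k$ the associated bidiagonal matrices. Let $\tilde{\mathscr{V}}_k$, $\tilde{\mathscr{U}}_k$, $\tilde{\mathscr{W}}_k$ and $\tilde{\mathscr{W}}_k^*$ be the $(N+1)$-mode tensors with frontal slices $\mathscr{V}_j$, $\mathscr{U}_j$, $\mathscr{W}_j:=\mathcal{M}(\mathscr{U}_j)$ and $\mathscr{W}_j^*:=\mathcal{M}^*(\mathscr{V}_j)$, respectively, for $j=1,\ldots,k$ (and $\tilde{\mathscr{V}}_{k+1}$ the one with frontal slices $\mathscr{V}_1,\ldots,\mathscr{V}_{k+1}$). Then $$\tilde{\mathscr{W}}_k=\tilde{\mathscr{V}}_k\times_{(N+1)}T_k^T+\beta_{k+1}\,\mathscr{Z}\times_{(N+1)}E_k=\tilde{\mathscr{V}}_{k+1}\times_{(N+1)}\bar T_k^T,$$ $$\tilde{\mathscr{W}}_k^*=\tilde{\mathscr{U}}_k\times_{(N+1)}T_k,$$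 where $\mathscr{Z}$ is the $(N+1)$-mode tensor with the $k$ column tensors $0,\ldots,0,\mathscr{V}_{k+1}$, and $E_k$ is the $k\times k$ matrix $E_k=[0,\ldots,0,e_k]$ with $e_k$ the $k$th column of the identity matrix of order $k$.
   Context: The $n$-mode product of $\mathscr{X}\in\mathbb{R}^{I_1\times\cdots\times I_N}$ with $U\in\mathbb{R}^{J\times I_n}$ is the tensor of size $I_1\times\cdots\times I_{n-1}\times J\times I_{n+1}\times\cdots\times I_N$ with entries $(\mathscr{X}\times_nU)_{i_1\cdots i_{n-1}ji_{n+1}\cdots i_N}=\sum_{i_n=1}^{I_n}x_{i_1i_2\cdots i_N}u_{ji_n}$. The norm $\|\mathscr{X}\|$ is induced by the inner product $\langle\mathscr{X},\mathscr{Y}\rangle=\sum x_{i_1\cdots i_N}y_{i_1\cdots i_N}$. The adjoint of $\mathcal{M}$ is $\mathcal{M}^*(\mathscr{Y})=\mathscr{Y}-\mathscr{Y}\times_1(A^{(1)})^T\times_2(A^{(2)})^T\cdots\times_N(A^{(N)})^T$. The frontal slices (also called column tensors) of an $(N+1)$-mode tensor are the $N$-mode tensors obtained by fixing its last index. GKB_BTF process with input $\mathcal{M}$, $\mathscr{F}$ and number $m$: set $\beta_1=\|\mathscr{F}\|$, $\mathscr{V}_1=\mathscr{F}/\beta_1$, $\mathscr{U}=\mathcal{M}^*(\mathscr{V}_1)$, $\alpha_1=\|\mathscr{U}\|$, $\mathscr{U}_1=\mathscr{U}/\alpha_1$. For $j=2,\ldots,m$: $\mathscr{V}=\mathcal{M}(\mathscr{U}_{j-1})-\alpha_{j-1}\mathscr{V}_{j-1}$,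 $\beta_j=\|\mathscr{V}\|$ (stop if $\beta_j=0$), $\mathscr{V}_j=\mathscr{V}/\beta_j$; $\mathscr{U}=\mathcal{M}^*(\mathscr{V}_j)-\beta_j\mathscr{U}_{j-1}$, $\alpha_j=\|\mathscr{U}\|$ (stop if $\alpha_j=0$), $\mathscr{U}_j=\mathscr{U}/\alpha_j$. No break-down means that $\alpha_j\neq0$ and $\beta_j\ne0$ for all $j=1,\ldots,m$. $\bar T_k$ is the $(k+1)\times k$ lower bidiagonal matrix with $(\bar T_k)_{jj}=\alpha_j$ and $(\bar T_k)_{j+1,j}=\beta_{j+1}$ for $j=1,\ldots,k$ and all other entries zero; $T_k$ is the $k\times k$ matrix formed by its first $k$ rows, so that the last row of $\bar T_k$ is $\beta_{k+1}e_k^T$. *)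

theory Defs
  imports Complex_Main "Jordan_Normal_Form.Matrix"
begin

text \<open>
  Real tensors of arbitrary order. A tensor carries the list of its mode sizes, and its entries
  are indexed by lists of the same length. As for matrices in
  \<^theory>\<open>Jordan_Normal_Form.Matrix\<close>, modes and entry indices count from 0, so the usual
  \<open>n\<close>-mode product is the one at mode \<open>n - 1\<close> here. The value 0 at invalid indices is only there to make equality of
  tensors coincide with equality of sizes and entries.
\<close>

definition valid_idx :: "nat list \<Rightarrow> nat list set" where
  "valid_idx ds = {is. list_all2 (<) is ds}"

typedef tensor = "{(ds, f :: nat list \<Rightarrow> real). \<forall>is. is \<notin> valid_idx ds \<longrightarrow> f is = 0}"
  by (rule exI[of _ "([], \<lambda>_. 0)"]) simp

setup_lifting type_definition_tensor

lift_definition dims :: "tensor \<Rightarrow> nat list" is fst .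

lift_definition entry :: "tensor \<Rightarrow> nat list \<Rightarrow> real" is snd .

lift_definition tensor :: "nat list \<Rightarrow> (nat list \<Rightarrow> real) \<Rightarrow> tensor"
  is "\<lambda>ds f. (ds, \<lambda>is. if is \<in> valid_idx ds then f is else 0)"
  by simp

lemma dims_tensor [simp]: "dims (tensor ds f) = ds"
  by transfer simp

lemma entry_tensor [simp]: "is \<in> valid_idx ds \<Longrightarrow> entry (tensor ds f) is = f is"
  by transfer simp

lemma tensor_eqI:
  assumes "dims X = dims Y" "\<And>is. is \<in> valid_idx (dims X) \<Longrightarrow> entry X is = entry Y is"
  shows "X = Y"
  using assms by transfer (auto simp: fun_eq_iff, metis)

lemma finite_valid_idx [simp]: "finite (valid_idx ds)"
proof (rule finite_subset)
  show "valid_idx ds \<subseteq> {is. set is \<subseteq> {..<Max (insert 0 (set ds))} \<and> length is = length ds}"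
    by (fastforce simp: valid_idx_def list_all2_conv_all_nth in_set_conv_nth
        intro: less_le_trans Max_ge)
  show "finite {is. set is \<subseteq> {..<Max (insert 0 (set ds))} \<and> length is = length ds}"
    by (rule finite_lists_length_eq) simp
qed

text \<open>Addition and subtraction are only meaningful for tensors of equal sizes.\<close>

instantiation tensor :: "{plus, minus, scaleR}"
begin

definition plus_tensor :: "tensor \<Rightarrow> tensor \<Rightarrow> tensor" where
  "X + Y = tensor (dims X) (\<lambda>is. entry X is + entry Y is)"

definition minus_tensor :: "tensor \<Rightarrow> tensor \<Rightarrow> tensor" where
  "X - Y = tensor (dims X) (\<lambda>is. entry X is - entry Y is)"

definition scaleR_tensor :: "real \<Rightarrow> tensor \<Rightarrow> tensor" where
  "c *\<^sub>R X = tensor (dims X) (\<lambda>is. c * entry X is)"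

instance ..

end

definition tensor_inner :: "tensor \<Rightarrow> tensor \<Rightarrow> real" where
  "tensor_inner X Y = (\<Sum>is\<in>valid_idx (dims X). entry X is * entry Y is)"

definition tensor_norm :: "tensor \<Rightarrow> real" where
  "tensor_norm X = sqrt (tensor_inner X X)"

definition zero_tensor :: "nat list \<Rightarrow> tensor" where
  "zero_tensor ds = tensor ds (\<lambda>_. 0)"

definition mode_prod :: "tensor \<Rightarrow> nat \<Rightarrow> real mat \<Rightarrow> tensor" where
  "mode_prod X n U = tensor ((dims X)[n := dim_row U])
     (\<lambda>is. \<Sum>i<dims X ! n. entry X (is[n := i]) * U $$ (is ! n, i))"

text \<open>\<open>X \<times>\<^sub>1 U\<^sub>1 \<times>\<^sub>2 U\<^sub>2 \<cdots> \<times>\<^sub>N U\<^sub>N\<close> for \<open>Us = [U\<^sub>1, \<dots>, U\<^sub>N]\<close>.\<close>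

definition mode_prods :: "tensor \<Rightarrow> real mat list \<Rightarrow> tensor" where
  "mode_prods X Us = foldl (\<lambda>Y n. mode_prod Y n (Us ! n)) X [0..<length Us]"

definition stein_op :: "real mat list \<Rightarrow> tensor \<Rightarrow> tensor" where
  "stein_op A X = X - mode_prods X A"

definition stein_adj :: "real mat list \<Rightarrow> tensor \<Rightarrow> tensor" where
  "stein_adj A Y = Y - mode_prods Y (map transpose_mat A)"

definition frontal_slice :: "tensor \<Rightarrow> nat \<Rightarrow> tensor" where
  "frontal_slice X j = tensor (butlast (dims X)) (\<lambda>is. entry X (is @ [j]))"

text \<open>The tensor with the given list of frontal slices, each of size \<open>ds\<close>.\<close>

definition of_frontal_slices :: "nat list \<Rightarrow> tensor list \<Rightarrow> tensor" where
  "of_frontal_slices ds Xs =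
     tensor (ds @ [length Xs]) (\<lambda>is. entry (Xs ! last is) (butlast is))"

lemma frontal_slice_of_frontal_slices:
  assumes "j < length Xs" "dims (Xs ! j) = ds"
  shows "frontal_slice (of_frontal_slices ds Xs) j = Xs ! j"
proof (rule tensor_eqI)
  show "dims (frontal_slice (of_frontal_slices ds Xs) j) = dims (Xs ! j)"
    using assms by (simp add: frontal_slice_def of_frontal_slices_def)
next
  fix "is"
  assume "is \<in> valid_idx (dims (frontal_slice (of_frontal_slices ds Xs) j))"
  hence *: "is \<in> valid_idx ds"
    by (simp add: frontal_slice_def of_frontal_slices_def)
  moreover from * assms(1) have "is @ [j] \<in> valid_idx (ds @ [length Xs])"
    by (auto simp: valid_idx_def intro: list_all2_appendI)
  ultimately show "entry (frontal_slice (of_frontal_slices ds Xs) j) is = entry (Xs ! j) is"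
    by (simp add: frontal_slice_def of_frontal_slices_def)
qed

text \<open>
  The process GKB\_BTF for an operator \<open>M\<close> with adjoint \<open>Ms\<close>, as the iteration of its state
  \<open>(V\<^sub>j, U\<^sub>j, \<alpha>\<^sub>j, \<beta>\<^sub>j)\<close>, with \<open>j\<close> counting from 1. The recursion does not stop at a
  vanishing norm but goes on with meaningless values (by \<open>1 / 0 = 0\<close>). Up to and including the
  first vanishing \<open>\<alpha>\<^sub>j\<close> or \<open>\<beta>\<^sub>j\<close> the norms are those of the process, so \<open>gkb_no_breakdown\<close>
  is the intended condition, and under it all states up to \<open>m\<close> are those of the process.
\<close>

definition gkb_init ::
    "(tensor \<Rightarrow> tensor) \<Rightarrow> (tensor \<Rightarrow> tensor) \<Rightarrow> tensor \<Rightarrow> tensor \<times> tensor \<times> real \<times> real" where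
  "gkb_init M Ms F =
     (let \<beta> = tensor_norm F; V = (1 / \<beta>) *\<^sub>R F;
          U' = Ms V; \<alpha> = tensor_norm U'; U = (1 / \<alpha>) *\<^sub>R U'
      in (V, U, \<alpha>, \<beta>))"

definition gkb_step ::
    "(tensor \<Rightarrow> tensor) \<Rightarrow> (tensor \<Rightarrow> tensor) \<Rightarrow>
     tensor \<times> tensor \<times> real \<times> real \<Rightarrow> tensor \<times> tensor \<times> real \<times> real" where
  "gkb_step M Ms = (\<lambda>(V, U, \<alpha>, \<beta>).
     (let V' = M U - \<alpha> *\<^sub>R V; \<beta>' = tensor_norm V'; V'' = (1 / \<beta>') *\<^sub>R V';
          U' = Ms V'' - \<beta>' *\<^sub>R U; \<alpha>' = tensor_norm U'; U'' = (1 / \<alpha>') *\<^sub>R U'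
      in (V'', U'', \<alpha>', \<beta>')))"

definition gkb ::
    "(tensor \<Rightarrow> tensor) \<Rightarrow> (tensor \<Rightarrow> tensor) \<Rightarrow> tensor \<Rightarrow> nat \<Rightarrow> tensor \<times> tensor \<times> real \<times> real" where
  "gkb M Ms F j = (gkb_step M Ms ^^ (j - 1)) (gkb_init M Ms F)"

definition gkb_V where "gkb_V M Ms F j = (case gkb M Ms F j of (V, U, \<alpha>, \<beta>) \<Rightarrow> V)"
definition gkb_U where "gkb_U M Ms F j = (case gkb M Ms F j of (V, U, \<alpha>, \<beta>) \<Rightarrow> U)"
definition gkb_alpha where "gkb_alpha M Ms F j = (case gkb M Ms F j of (V, U, \<alpha>, \<beta>) \<Rightarrow> \<alpha>)"
definition gkb_beta where "gkb_beta M Ms F j = (case gkb M Ms F j of (V, U, \<alpha>, \<beta>) \<Rightarrow> \<beta>)"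

definition gkb_no_breakdown ::
    "(tensor \<Rightarrow> tensor) \<Rightarrow> (tensor \<Rightarrow> tensor) \<Rightarrow> tensor \<Rightarrow> nat \<Rightarrow> bool" where
  "gkb_no_breakdown M Ms F m \<longleftrightarrow>
     (\<forall>j\<in>{1..m}. gkb_alpha M Ms F j \<noteq> 0 \<and> gkb_beta M Ms F j \<noteq> 0)"

text \<open>
  \<open>\<alpha>\<close> and \<open>\<beta>\<close> are indexed from 1, matrix entries from 0.
\<close>

definition bidiag_bar :: "(nat \<Rightarrow> real) \<Rightarrow> (nat \<Rightarrow> real) \<Rightarrow> nat \<Rightarrow> real mat" where
  "bidiag_bar \<alpha> \<beta> k = mat (k + 1) k
     (\<lambda>(i, j). if i = j then \<alpha> (j + 1) else if i = j + 1 then \<beta> (j + 2) else 0)"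

definition bidiag :: "(nat \<Rightarrow> real) \<Rightarrow> (nat \<Rightarrow> real) \<Rightarrow> nat \<Rightarrow> real mat" where
  "bidiag \<alpha> \<beta> k = mat k k (\<lambda>(i, j). bidiag_bar \<alpha> \<beta> k $$ (i, j))"

end

theory Submission
  imports Defs
begin

text \<open>
  Undoing the normalizations turns the two recurrences of the process into
  \<open>\<M>(U\<^sub>j) = \<alpha>\<^sub>j V\<^sub>j + \<beta>\<^sub>j\<^sub>+\<^sub>1 V\<^sub>j\<^sub>+\<^sub>1\<close> and
  \<open>\<M>*(V\<^sub>j) = \<alpha>\<^sub>j U\<^sub>j + \<beta>\<^sub>j U\<^sub>j\<^sub>-\<^sub>1\<close> (without the last term for \<open>j = 1\<close>). A mode product in the last mode takes linear
  combinations of frontal slices, with the rows of the matrix as coefficients, so the claimed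
  identities are these recurrences slice by slice.
\<close>

text \<open>Splits an index of an (N+1)-mode tensor into an index inside a slice and the number of
  the slice; every entrywise comparison below starts with it.\<close>

lemma valid_idx_snoc_iff:
  "is \<in> valid_idx (ds @ [n]) \<longleftrightarrow> (\<exists>js j. is = js @ [j] \<and> js \<in> valid_idx ds \<and> j < n)"
proof
  assume "is \<in> valid_idx (ds @ [n])"
  then show "\<exists>js j. is = js @ [j] \<and> js \<in> valid_idx ds \<and> j < n"
    by (auto simp: valid_idx_def list_all2_append2 list_all2_Cons2)
qed (auto simp: valid_idx_def intro: list_all2_appendI)

lemma length_valid_idx: "is \<in> valid_idx ds \<Longrightarrow> length is = length ds"
  by (auto simp: valid_idx_def dest: list_all2_lengthD)

lemma dims_plus [simp]: "dims (X + Y) = dims X"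
  and dims_minus [simp]: "dims (X - Y) = dims X"
  and dims_scaleR [simp]: "dims (c *\<^sub>R X) = dims X"
  by (simp_all add: plus_tensor_def minus_tensor_def scaleR_tensor_def)

lemma entry_plus: "is \<in> valid_idx (dims X) \<Longrightarrow> entry (X + Y) is = entry X is + entry Y is"
  and entry_minus: "is \<in> valid_idx (dims X) \<Longrightarrow> entry (X - Y) is = entry X is - entry Y is"
  and entry_scaleR: "is \<in> valid_idx (dims X) \<Longrightarrow> entry (c *\<^sub>R X) is = c * entry X is"
  by (simp_all add: plus_tensor_def minus_tensor_def scaleR_tensor_def)

lemma dims_stein_op [simp]: "dims (stein_op A X) = dims X"
  and dims_stein_adj [simp]: "dims (stein_adj A X) = dims X"
  by (simp_all add: stein_op_def stein_adj_def)

lemma dims_of_frontal_slices [simp]: "dims (of_frontal_slices ds Xs) = ds @ [length Xs]"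
  by (simp add: of_frontal_slices_def)

lemma entry_of_frontal_slices:
  assumes "is \<in> valid_idx ds" "j < length Xs"
  shows "entry (of_frontal_slices ds Xs) (is @ [j]) = entry (Xs ! j) is"
  using assms by (auto simp: of_frontal_slices_def valid_idx_snoc_iff)

lemma dims_last_mode_prod [simp]:
  "dims (mode_prod (of_frontal_slices ds Xs) (length ds) B) = ds @ [dim_row B]"
  by (simp add: mode_prod_def)

lemma entry_last_mode_prod:
  assumes "is \<in> valid_idx ds" "j < dim_row B"
  shows "entry (mode_prod (of_frontal_slices ds Xs) (length ds) B) (is @ [j]) =
    (\<Sum>i<length Xs. entry (Xs ! i) is * B $$ (j, i))"
proof -
  have "is @ [j] \<in> valid_idx (ds @ [dim_row B])"
    using assms by (auto simp: valid_idx_snoc_iff)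
  then show ?thesis
    using assms length_valid_idx[OF assms(1)]
    \<comment> \<open>Modes count from 0, so mode \<open>length ds\<close> is the last one.
      Rewriting \<open>length ds\<close> to \<open>length is\<close> shows that the update hits
      exactly the appended position.\<close>
    by (auto simp: mode_prod_def entry_of_frontal_slices list_update_append nth_append
        simp flip: length_valid_idx[OF assms(1)] intro!: sum.cong)
qed

text \<open>The exponent \<open>j - 1\<close> in \<open>gkb\<close> is truncated, so index 0 already
  gives the initial state; only from \<open>j = 1\<close> on does the successor apply a
  step.\<close>

lemma gkb_Suc: "1 \<le> j \<Longrightarrow> gkb M Ms F (Suc j) = gkb_step M Ms (gkb M Ms F j)"
  by (cases j) (auto simp: gkb_def)

context
  fixes M Ms :: "tensor \<Rightarrow> tensor" and F :: tensor
  assumes dims_M: "\<And>X. dims (M X) = dims X" and dims_Ms: "\<And>X. dims (Ms X) = dims X"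
begin

text \<open>A difference takes its size from its first operand, here always an image under
  \<open>M\<close> or \<open>Ms\<close>. The formulas for entries hold only at valid indices and
  rely on these sizes.\<close>

lemma dims_gkb:
  "1 \<le> j \<Longrightarrow> dims (gkb_V M Ms F j) = dims F \<and> dims (gkb_U M Ms F j) = dims F"
proof (induction j rule: nat_induct_at_least)
  case base
  then show ?case
    by (simp add: gkb_V_def gkb_U_def gkb_def gkb_init_def Let_def dims_Ms)
next
  case (Suc j)
  then show ?case
    by (simp add: gkb_V_def gkb_U_def gkb_Suc gkb_step_def Let_def dims_M dims_Ms split: prod.splits)
qed

text \<open>Multiplying V_{j+1} by the nonzero norm that was divided out gives back M(U_j) minus its
  V_j term.\<close>

lemma entry_M_gkb_U:
  assumes "1 \<le> j" "gkb_beta M Ms F (Suc j) \<noteq> 0" "is \<in> valid_idx (dims F)"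
  shows "entry (M (gkb_U M Ms F j)) is =
    gkb_alpha M Ms F j * entry (gkb_V M Ms F j) is +
    gkb_beta M Ms F (Suc j) * entry (gkb_V M Ms F (Suc j)) is"
  using assms dims_gkb[OF assms(1)]
  by (simp add: gkb_V_def gkb_U_def gkb_alpha_def gkb_beta_def gkb_Suc gkb_step_def Let_def
      dims_M entry_minus entry_scaleR split: prod.splits)

text \<open>The initial step subtracts nothing before normalizing, hence the single term.\<close>

lemma entry_Ms_gkb_V_1:
  assumes "gkb_alpha M Ms F 1 \<noteq> 0" "is \<in> valid_idx (dims F)"
  shows "entry (Ms (gkb_V M Ms F 1)) is = gkb_alpha M Ms F 1 * entry (gkb_U M Ms F 1) is"
  using assms
  by (simp add: gkb_V_def gkb_U_def gkb_alpha_def gkb_def gkb_init_def Let_def dims_Ms entry_scaleR)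

lemma entry_Ms_gkb_V_Suc:
  assumes "1 \<le> j" "gkb_alpha M Ms F (Suc j) \<noteq> 0" "is \<in> valid_idx (dims F)"
  shows "entry (Ms (gkb_V M Ms F (Suc j))) is =
    gkb_alpha M Ms F (Suc j) * entry (gkb_U M Ms F (Suc j)) is +
    gkb_beta M Ms F (Suc j) * entry (gkb_U M Ms F j) is"
  using assms dims_gkb[OF assms(1)]
  by (simp add: gkb_V_def gkb_U_def gkb_alpha_def gkb_beta_def gkb_Suc gkb_step_def Let_def
      dims_M dims_Ms entry_minus entry_scaleR split: prod.splits)

end

text \<open>Column \<open>j\<close> has its two nonzero entries in rows \<open>j\<close> and
  \<open>Suc j\<close>, both within the \<open>k + 1\<close> rows. In use, \<open>f i\<close> is an
  entry of V_{i+1}.\<close>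

lemma sum_bidiag_bar_column:
  assumes "j < k"
  shows "(\<Sum>i<Suc k. f i * bidiag_bar \<alpha> \<beta> k $$ (i, j)) = f j * \<alpha> (Suc j) + f (Suc j) * \<beta> (j + 2)"
proof -
  have "(\<Sum>i<Suc k. f i * bidiag_bar \<alpha> \<beta> k $$ (i, j)) =
      (\<Sum>i<Suc k. (if i = j then f i * \<alpha> (Suc j) else 0) + (if i = Suc j then f i * \<beta> (j + 2) else 0))"
    using assms by (intro sum.cong) (auto simp: bidiag_bar_def)
  also have "\<dots> = f j * \<alpha> (Suc j) + f (Suc j) * \<beta> (j + 2)"
    using assms by (simp add: sum.distrib del: sum.lessThan_Suc)
  finally show ?thesis .
qed

lemma sum_bidiag_row:
  assumes "j < k"
  shows "(\<Sum>i<k. f i * bidiag \<alpha> \<beta> k $$ (j, i)) =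
    f j * \<alpha> (Suc j) + (if j = 0 then 0 else f (j - 1) * \<beta> (Suc j))"
proof -
  have "(\<Sum>i<k. f i * bidiag \<alpha> \<beta> k $$ (j, i)) =
      (\<Sum>i<k. (if i = j then f i * \<alpha> (Suc j) else 0) +
        (if i = j - 1 then if j = 0 then 0 else f i * \<beta> (Suc j) else 0))"
    using assms by (intro sum.cong) (auto simp: bidiag_def bidiag_bar_def)
  also have "\<dots> = f j * \<alpha> (Suc j) + (if j = 0 then 0 else f (j - 1) * \<beta> (Suc j))"
    using assms by (simp add: sum.distrib)
  finally show ?thesis .
qed

text \<open>With its single 1 in the bottom right corner, the matrix keeps the last slice in place
  and annihilates the others.\<close>

lemma index_last_unit_cols:
  assumes "i < k" "j < k"
  shows "mat_of_cols k (replicate (k - 1) (0\<^sub>v k) @ [unit_vec k (k - 1)]) $$ (j, i) =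
    (if i = k - 1 \<and> j = k - 1 then 1 else (0 :: real))"
  using assms by (auto simp: mat_of_cols_index nth_append)

theorem theorem3p1:
  fixes N k :: nat and I :: "nat list" and A :: "real mat list" and F :: tensor
    and M Ms :: "tensor \<Rightarrow> tensor" and V U W Ws :: "nat \<Rightarrow> tensor" and \<alpha> \<beta> :: "nat \<Rightarrow> real"
    and Vt :: "nat \<Rightarrow> tensor" and Ut Wt Wst Z :: tensor and T Tbar E :: "real mat"
  assumes "length I = N" and "length A = N"
    and "\<forall>n<N. A ! n \<in> carrier_mat (I ! n) (I ! n)"
    and "dims F = I"
    and "k \<ge> 1"
    and "M = stein_op A" and "Ms = stein_adj A"
    and "gkb_no_breakdown M Ms F (k + 1)"
    and "V = gkb_V M Ms F" and "U = gkb_U M Ms F"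
    and "\<alpha> = gkb_alpha M Ms F" and "\<beta> = gkb_beta M Ms F"
    and "T = bidiag \<alpha> \<beta> k" and "Tbar = bidiag_bar \<alpha> \<beta> k"
    and "\<forall>j. W j = M (U j)" and "\<forall>j. Ws j = Ms (V j)"
    and "\<forall>l. Vt l = of_frontal_slices I (map V [1..<l + 1])"
    and "Ut = of_frontal_slices I (map U [1..<k + 1])"
    and "Wt = of_frontal_slices I (map W [1..<k + 1])"
    and "Wst = of_frontal_slices I (map Ws [1..<k + 1])"
    and "Z = of_frontal_slices I (replicate (k - 1) (zero_tensor I) @ [V (k + 1)])"
    and "E = mat_of_cols k (replicate (k - 1) (0\<^sub>v k) @ [unit_vec k (k - 1)])"
  shows "Wt = mode_prod (Vt k) N (transpose_mat T) + \<beta> (k + 1) *\<^sub>R mode_prod Z N E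
    \<and> mode_prod (Vt k) N (transpose_mat T) + \<beta> (k + 1) *\<^sub>R mode_prod Z N E
        = mode_prod (Vt (k + 1)) N (transpose_mat Tbar)
    \<and> Wst = mode_prod Ut N T"
proof -
  have dM: "\<And>X. dims (M X) = dims X" and dMs: "\<And>X. dims (Ms X) = dims X"
    using assms(6,7) by simp_all
  have nz: "\<alpha> j \<noteq> 0 \<and> \<beta> j \<noteq> 0" if "1 \<le> j" "j \<le> k + 1" for j
    using assms(8,11,12) that by (auto simp: gkb_no_breakdown_def)
  \<comment> \<open>Slice \<open>j\<close> belongs to step \<open>j + 1\<close>, so \<beta> is
    needed up to \<open>k + 1\<close>; this is where the process must run to m = k + 1.\<close>
  have W: "entry (W (Suc j)) is =
      \<alpha> (Suc j) * entry (V (Suc j)) is + \<beta> (j + 2) * entry (V (j + 2)) is"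
    if "is \<in> valid_idx I" "j < k" for "is" j
    using entry_M_gkb_U[where M = M and Ms = Ms and F = F and j = "Suc j", OF dM dMs] that
      nz[of "j + 2"] assms(4,9-12,15) by simp
  have Ws: "entry (Ws (Suc j)) is =
      \<alpha> (Suc j) * entry (U (Suc j)) is + (if j = 0 then 0 else \<beta> (Suc j) * entry (U j) is)"
    if "is \<in> valid_idx I" "j < k" for "is" j
    using entry_Ms_gkb_V_1[where M = M and Ms = Ms and F = F, OF dM dMs]
      entry_Ms_gkb_V_Suc[where M = M and Ms = Ms and F = F and j = j, OF dM dMs] that
      nz[of "Suc j"] assms(4,9-12,16) by (cases j) auto
  have N: "N = length I" using assms(1) by simp
  have dimE: "dim_row E = k" using assms(22) by simp
  have dimT: "dim_row T = k" "dim_col T = k" "dim_col Tbar = k" "dim_row Tbar = Suc k"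
    using assms(13,14) by (simp_all add: bidiag_def bidiag_bar_def)
  have Vt: "Vt l = of_frontal_slices I (map V [1..<l + 1])" for l
    using assms(17) by simp
  have VTbar: "entry (mode_prod (Vt (k + 1)) N (transpose_mat Tbar)) (is @ [j]) =
      (\<Sum>i<Suc k. entry (V (Suc i)) is * Tbar $$ (i, j))"
    if "is \<in> valid_idx I" "j < k" for "is" j
    using that by (simp add: Vt N entry_last_mode_prod dimT nth_append del: upt_Suc sum.lessThan_Suc)
  \<comment> \<open>Since \<open>T\<close> consists of the first \<open>k\<close> rows of
    \<open>Tbar\<close>, this is the sum in \<open>VTbar\<close> without the summand
    \<open>i = k\<close>.\<close>
  have VT: "entry (mode_prod (Vt k) N (transpose_mat T)) (is @ [j]) =
      (\<Sum>i<k. entry (V (Suc i)) is * Tbar $$ (i, j))"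
    if "is \<in> valid_idx I" "j < k" for "is" j
  proof -
    have "T $$ (i, j) = Tbar $$ (i, j)" if "i < k" for i
      using that \<open>j < k\<close> assms(13,14) by (simp add: bidiag_def)
    then show ?thesis
      using that by (simp add: Vt N entry_last_mode_prod dimT del: upt_Suc)
  qed
  have E: "E $$ (j, i) = (if i = k - 1 \<and> j = k - 1 then 1 else 0)" if "i < k" "j < k" for i j
    using index_last_unit_cols[OF that] assms(22) by simp
  have ZE: "entry (mode_prod Z N E) (is @ [j]) = (if Suc j = k then entry (V (k + 1)) is else 0)"
    if "is \<in> valid_idx I" "j < k" for "is" j
  proof -
    have "entry (mode_prod Z N E) (is @ [j]) =
        (\<Sum>i<k. entry ((replicate (k - 1) (zero_tensor I) @ [V (k + 1)]) ! i) is * E $$ (j, i))"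
      using that assms(5) by (simp add: assms(21) N entry_last_mode_prod dimE)
    also have "\<dots> = (\<Sum>i<k. if i = k - 1 then if Suc j = k then entry (V (k + 1)) is else 0 else 0)"
      using that by (intro sum.cong) (auto simp: E nth_append)
    also have "\<dots> = (if Suc j = k then entry (V (k + 1)) is else 0)"
      using assms(5) by simp
    finally show ?thesis .
  qed
  \<comment> \<open>By this last row, the missing summand is nonzero at most in the last slice,
    where it is the contribution of \<open>Z\<close>.\<close>
  have Tbar_last: "Tbar $$ (k, j) = (if Suc j = k then \<beta> (k + 1) else 0)" if "j < k" for j
    using that by (auto simp: assms(14) bidiag_bar_def)
  have dVT: "dims (mode_prod (Vt k) N (transpose_mat T)) = I @ [k]"
    and dVTbar: "dims (mode_prod (Vt (k + 1)) N (transpose_mat Tbar)) = I @ [k]"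
    and dZE: "dims (mode_prod Z N E) = I @ [k]"
    and dUT: "dims (mode_prod Ut N T) = I @ [k]"
    by (simp_all only: Vt N assms(18,21) dims_last_mode_prod index_transpose_mat dimT dimE)
  have split: "mode_prod (Vt k) N (transpose_mat T) + \<beta> (k + 1) *\<^sub>R mode_prod Z N E
      = mode_prod (Vt (k + 1)) N (transpose_mat Tbar)" (is "?L = ?R")
  proof (rule tensor_eqI)
    show "dims ?L = dims ?R" by (simp only: dims_plus dVT dVTbar)
    fix "is" assume "is \<in> valid_idx (dims ?L)"
    then have "is \<in> valid_idx (I @ [k])" by (simp only: dims_plus dVT)
    moreover from this obtain js j where "is = js @ [j]" "js \<in> valid_idx I" "j < k"
      by (auto simp: valid_idx_snoc_iff)
    ultimately show "entry ?L is = entry ?R is"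
      \<comment> \<open>Here the sum up to \<open>Suc k\<close> is allowed to unfold, which splits
        off the summand \<open>i = k\<close>.\<close>
      using VTbar[of js j] VT[of js j] ZE[of js j] Tbar_last[of j]
      by (simp add: entry_plus entry_scaleR dVT dZE)
  qed
  \<comment> \<open>The columns of \<open>Tbar\<close> are the coefficients in the recurrence for
    M(U_j), so \<open>Wt\<close> is compared with this form; \<open>split\<close> then gives the
    other one.\<close>
  have Wt: "Wt = mode_prod (Vt (k + 1)) N (transpose_mat Tbar)" (is "_ = ?R")
  proof (rule tensor_eqI)
    show "dims Wt = dims ?R" unfolding dVTbar by (simp add: assms(19) del: upt_Suc)
    fix "is" assume "is \<in> valid_idx (dims Wt)"
    then obtain js j where *: "is = js @ [j]" "js \<in> valid_idx I" "j < k"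
      by (auto simp: valid_idx_snoc_iff assms(19) simp del: upt_Suc)
    then have "entry Wt is = entry (W (Suc j)) js"
      by (simp add: assms(19) entry_of_frontal_slices del: upt_Suc)
    also have "\<dots> = entry ?R is"
      using * W[of js j] VTbar[of js j]
        sum_bidiag_bar_column[of j k "\<lambda>i. entry (V (Suc i)) js" \<alpha> \<beta>]
      by (simp add: assms(14) del: sum.lessThan_Suc)
    finally show "entry Wt is = entry ?R is" .
  qed
  have Wst: "Wst = mode_prod Ut N T" (is "_ = ?R")
  proof (rule tensor_eqI)
    show "dims Wst = dims ?R" unfolding dUT by (simp add: assms(20) del: upt_Suc)
    fix "is" assume "is \<in> valid_idx (dims Wst)"
    then obtain js j where *: "is = js @ [j]" "js \<in> valid_idx I" "j < k"
      by (auto simp: valid_idx_snoc_iff assms(20) simp del: upt_Suc)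
    then have "entry Wst is = entry (Ws (Suc j)) js"
      by (simp add: assms(20) entry_of_frontal_slices del: upt_Suc)
    also have "\<dots> = (\<Sum>i<k. entry (U (Suc i)) js * T $$ (j, i))"
      \<comment> \<open>For \<open>j > 0\<close>, \<open>f (j - 1)\<close> is the entry of
        \<open>U j\<close>, as in the recurrence; for \<open>j = 0\<close> both sides lack this
        term.\<close>
      using * Ws[of js j] sum_bidiag_row[of j k "\<lambda>i. entry (U (Suc i)) js" \<alpha> \<beta>]
      by (simp add: assms(13))
    also have "\<dots> = entry ?R is"
      using * by (simp add: assms(18) N entry_last_mode_prod dimT del: upt_Suc)
    finally show "entry Wst is = entry ?R is" .
  qed
  show ?thesis using split Wt Wst by simp
qed

end
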